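(* Let $p$ be a prime, $n\ge1$, and let $V$ be the Verschiebung (shift) operator on $W_n(\mathbb{F}_p)$, viewed as $\mathbb{F}_p^n$, so that $V^{n}=0$. Then $$(I-V)^{-1}=\sum_{k=0}^{n-1}V^k,$$ and this is computed in $O(n)$ operations. The classical method via Witt's phantom (ghost) polynomials costs $\Theta(n^2)$.
   Context: The paper identifies $W_n(\mathbb{F}_p)$ with the vectors $(a_0,\dots,a_{n-1})\in\mathbb{F}_p^n$, with component-by-component sums, and $V(a_0,a_1,\dots,a_{n-1})=(0,a_0,\dots,a_{n-2})$. The nilpotent operational system is $(W_n(\mathbb{F}_p),V,n-1,O(1))$, where $O(1)$ denotes the cost assigned to applying $V$ once to a vector by incremental shifting (not the cost of multiplying in the ring $W_n$). The computational task is: given a vector $a$, compute $(I-V)^{-1}a$. The classical method iteratively solves the triangular system $W_k=\sum_{i=0}^k p^iX_i^{p^{k-i}}$, $k=0,\dots,n-1$. *)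

theory Defs
  imports
    Complex_Main
    "HOL-Library.Landau_Symbols"
    "Jordan_Normal_Form.Matrix"
    "Berlekamp_Zassenhaus.Finite_Field"
begin

text \<open>
  The space of Witt vectors of length \<open>n\<close> over the prime field is \<open>carrier_vec n\<close> over
  \<open>'p mod_ring\<close> with \<open>'p :: prime_card\<close>, so \<open>p = CARD('p)\<close>. Sums are taken component by
  component; the Witt ring structure is not used.
\<close>

definition verschiebung :: "'a::zero vec \<Rightarrow> 'a vec" where
  "verschiebung a = vec (dim_vec a) (\<lambda>i. if i = 0 then 0 else a $ (i - 1))"

definition witt_poly :: "nat \<Rightarrow> nat \<Rightarrow> 'a::comm_semiring_1 vec \<Rightarrow> 'a" where
  "witt_poly p k X = (\<Sum>i\<le>k. of_nat p ^ i * (X $ i) ^ (p ^ (k - i)))"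

text \<open>
  Both algorithms are straight-line programs on one machine. Its registers hold vectors, and a
  cell \<open>(r, i)\<close> is the coordinate \<open>i\<close> of the register \<open>r\<close>; the first register or cell in
  an instruction is its destination. Register 0 holds the input at the start and the output at the end; all other
  registers start as the zero vector. There is deliberately no instruction for the sum of two
  vectors: additions are paid for coordinate by coordinate.
\<close>

type_synonym cell = "nat \<times> nat"

datatype arith_op = Add | Sub | Mul | Div

datatype 'a instr =
    Shift nat nat
  | Load cell 'a
  | Move cell cell
  | Arith arith_op cell cell cell

fun arith :: "arith_op \<Rightarrow> 'a::field \<Rightarrow> 'a \<Rightarrow> 'a" where
  "arith Add x y = x + y"
| "arith Sub x y = x - y"
| "arith Mul x y = x * y"
| "arith Div x y = x / y"

definition get :: "(nat \<Rightarrow> 'a vec) \<Rightarrow> cell \<Rightarrow> 'a" where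
  "get s c = s (fst c) $ snd c"

definition put :: "cell \<Rightarrow> 'a \<Rightarrow> (nat \<Rightarrow> 'a vec) \<Rightarrow> nat \<Rightarrow> 'a vec" where
  "put c x s = s(fst c := update_vec (s (fst c)) (snd c) x)"

fun exec :: "'a::field instr \<Rightarrow> (nat \<Rightarrow> 'a vec) \<Rightarrow> nat \<Rightarrow> 'a vec" where
  "exec (Shift d r) s = s(d := verschiebung (s r))"
| "exec (Load d x) s = put d x s"
| "exec (Move d c) s = put d (get s c) s"
| "exec (Arith f d c c') s = put d (arith f (get s c) (get s c')) s"

definition run :: "'a::field instr list \<Rightarrow> 'a vec \<Rightarrow> 'a vec" where
  "run P a = fold exec P (\<lambda>r. if r = 0 then a else 0\<^sub>v (dim_vec a)) 0"

text \<open>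
  The parameter \<open>t\<close> is the cost assigned to one application of the shift to a vector. Every
  other instruction touches single field elements and costs one unit.
\<close>

fun instr_cost :: "nat \<Rightarrow> 'a instr \<Rightarrow> nat" where
  "instr_cost t (Shift d r) = t"
| "instr_cost t (Load d x) = 1"
| "instr_cost t (Move d c) = 1"
| "instr_cost t (Arith f d c c') = 1"

definition prog_cost :: "nat \<Rightarrow> 'a instr list \<Rightarrow> nat" where
  "prog_cost t P = sum_list (map (instr_cost t) P)"

text \<open>
  The iterates \<open>x\<^sub>0 = a\<close>, \<open>x\<^sub>k = a + V x\<^sub>k\<^sub>-\<^sub>1\<close> are the partial sums of the powers of \<open>V\<close> applied to
  \<open>a\<close>. The step from \<open>k - 1\<close> to \<open>k\<close> leaves the coordinates below \<open>k\<close> unchanged, and those above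
  \<open>k\<close> are not needed for later steps, so that one shift and one addition in the coordinate \<open>k\<close>
  suffice for a step.
\<close>

definition neumann_prog :: "nat \<Rightarrow> 'a instr list" where
  "neumann_prog n =
     concat (map (\<lambda>k. [Shift 1 0, Arith Add (0, k) (0, k) (1, k)]) [1..<n])"

text \<open>
  Forward substitution for the system \<open>W\<^sub>k = witt_poly p k X\<close>, \<open>k < n\<close>: at stage \<open>k\<close> the terms
  with \<open>i < k\<close> are subtracted from \<open>W\<^sub>k\<close>, and the remainder is divided by \<open>p ^ k\<close>. In register 0
  the number \<open>W\<^sub>k\<close> is overwritten by \<open>X\<^sub>k\<close>. At the end of stage \<open>k\<close>, the cells \<open>(1, i)\<close> and
  \<open>(2, i)\<close> with \<open>i \<le> k\<close> hold \<open>X\<^sub>i ^ (p ^ (k - i))\<close> and \<open>p ^ i\<close>; \<open>(3, 0)\<close> holds \<open>p\<close>, and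
  \<open>(4, 0)\<close> is scratch. Thus a power in a new stage is the \<open>p\<close>-th power of the one in the previous
  stage, and this takes \<open>p - 1\<close> multiplications, a number that does not depend on \<open>n\<close>.
\<close>

definition frobenius_prog :: "nat \<Rightarrow> nat \<Rightarrow> 'a instr list" where
  "frobenius_prog p i =
     Move (4, 0) (1, i) # replicate (p - 1) (Arith Mul (1, i) (1, i) (4, 0))"

definition ghost_term_prog :: "nat \<Rightarrow> nat \<Rightarrow> nat \<Rightarrow> 'a instr list" where
  "ghost_term_prog p k i =
     frobenius_prog p i @ [Arith Mul (4, 0) (2, i) (1, i), Arith Sub (0, k) (0, k) (4, 0)]"

definition ghost_stage_prog :: "nat \<Rightarrow> nat \<Rightarrow> 'a::field instr list" where
  "ghost_stage_prog p k =
     concat (map (ghost_term_prog p k) [0..<k])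
     @ [if k = 0 then Load (2, 0) 1 else Arith Mul (2, k) (2, k - 1) (3, 0),
        Arith Div (0, k) (0, k) (2, k),
        Move (1, k) (0, k)]"

definition ghost_prog :: "nat \<Rightarrow> nat \<Rightarrow> 'a::field instr list" where
  "ghost_prog p n = Load (3, 0) (of_nat p) # concat (map (ghost_stage_prog p) [0..<n])"

end

theory Submission
  imports Defs
begin

text \<open>
  On vectors, \<open>I - V\<close> is the backward difference operator \<open>a\<^sub>i \<mapsto> a\<^sub>i - a\<^sub>i\<^sub>-\<^sub>1\<close>, whose inverse is
  the formation of prefix sums (\<open>prefix_sums_difference\<close>, \<open>difference_prefix_sums\<close>). The power
  \<open>V\<^sup>k\<close> delays a vector by \<open>k\<close> places, and so the coordinate \<open>i\<close> of \<open>\<Sum>\<^sub>k V\<^sup>k a\<close> is again the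
  prefix sum \<open>a\<^sub>0 + \<dots> + a\<^sub>i\<close> (\<open>neumann_series_eq_prefix_sums\<close>). A program that adds each
  coordinate to the next one in order forms these prefix sums with one shift and one addition for
  every coordinate but the first, hence in linear time when a shift has bounded cost.

  The ghost system is triangular: \<open>X\<^sub>k\<close> enters \<open>W\<^sub>k\<close> only through the linear term \<open>p\<^sup>k X\<^sub>k\<close>. As
  soon as \<open>p\<close> is invertible, the system therefore determines the coordinates one after the other
  (\<open>witt_poly_inject\<close>), and forward substitution finds them. The invariant behind the substitution
  (\<open>ghost_inv\<close>) is that the power table is one Frobenius step behind: each stage raises all its
  entries to the \<open>p\<close>-th power and thereby obtains exactly the powers in the new equation. A stage
  \<open>k\<close> touches \<open>k\<close> earlier coordinates, at a price of \<open>p + 2\<close> units each; the sum over \<open>k < n\<close> is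
  quadratic in \<open>n\<close> since \<open>p\<close> is fixed.
\<close>

section \<open>Prefix sums invert the difference operator\<close>

definition prefix_sums :: "'a::comm_monoid_add vec \<Rightarrow> 'a vec" where
  "prefix_sums a = vec (dim_vec a) (\<lambda>i. \<Sum>j\<le>i. a $ j)"

lemma dim_verschiebung [simp]: "dim_vec (verschiebung a) = dim_vec a"
  by (simp add: verschiebung_def)

lemma dim_prefix_sums [simp]: "dim_vec (prefix_sums a) = dim_vec a"
  by (simp add: prefix_sums_def)

lemma index_verschiebung [simp]:
  "i < dim_vec a \<Longrightarrow> verschiebung a $ i = (if i = 0 then 0 else a $ (i - 1))"
  by (simp add: verschiebung_def)

lemma dim_verschiebung_funpow [simp]: "dim_vec ((verschiebung ^^ k) a) = dim_vec a"
  by (induction k) auto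

lemma index_verschiebung_funpow:
  "i < dim_vec a \<Longrightarrow> (verschiebung ^^ k) a $ i = (if i < k then 0 else a $ (i - k))"
  by (induction k arbitrary: i) auto

lemma verschiebung_nilpotent: "(verschiebung ^^ dim_vec a) a = 0\<^sub>v (dim_vec a)"
  by (rule eq_vecI) (simp_all add: index_verschiebung_funpow)

lemma prefix_sums_difference:
  fixes a :: "'a::ab_group_add vec"
  shows "prefix_sums (a - verschiebung a) = a"
proof (rule eq_vecI)
  fix i
  assume "i < dim_vec a"
  then have "(\<Sum>j\<le>i. (a - verschiebung a) $ j) = a $ i"
    by (induction i) auto
  with \<open>i < dim_vec a\<close> show "prefix_sums (a - verschiebung a) $ i = a $ i"
    by (simp add: prefix_sums_def)
qed simp

lemma difference_prefix_sums:
  fixes a :: "'a::ab_group_add vec"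
  shows "prefix_sums a - verschiebung (prefix_sums a) = a"
proof (rule eq_vecI)
  fix i
  assume "i < dim_vec a"
  then show "(prefix_sums a - verschiebung (prefix_sums a)) $ i = a $ i"
    by (cases i) (simp_all add: prefix_sums_def)
qed simp

lemma bij_betw_difference:
  "bij_betw (\<lambda>a. a - verschiebung a)
     (carrier_vec n :: 'a::ab_group_add vec set) (carrier_vec n)"
proof (rule bij_betw_byWitness[where f' = prefix_sums])
  show "\<forall>a \<in> carrier_vec n :: 'a vec set. prefix_sums (a - verschiebung a) = a"
    by (simp add: prefix_sums_difference)
  show "\<forall>a \<in> carrier_vec n :: 'a vec set. prefix_sums a - verschiebung (prefix_sums a) = a"
    by (simp add: difference_prefix_sums)
  show "(\<lambda>a. a - verschiebung a) ` carrier_vec n \<subseteq> (carrier_vec n :: 'a vec set)"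
    by (auto intro: carrier_vecI)
  show "prefix_sums ` carrier_vec n \<subseteq> (carrier_vec n :: 'a vec set)"
    by (auto intro: carrier_vecI)
qed

lemma inv_into_difference:
  fixes a :: "'a::ab_group_add vec"
  assumes "a \<in> carrier_vec n"
  shows "inv_into (carrier_vec n) (\<lambda>a. a - verschiebung a) a = prefix_sums a"
  using assms
  by (intro inv_into_f_eq bij_betw_imp_inj_on[OF bij_betw_difference] difference_prefix_sums)
    (auto intro: carrier_vecI)

text \<open>
  In the coordinate \<open>i\<close> the summand \<open>V\<^sup>k a\<close> is \<open>a\<^sub>i\<^sub>-\<^sub>k\<close> for \<open>k \<le> i\<close> and zero afterwards: the
  Neumann series lists the terms of the prefix sum in reverse order.
\<close>

lemma neumann_series_eq_prefix_sums:
  fixes a :: "'a::comm_monoid_add vec"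
  assumes "a \<in> carrier_vec n"
  shows "finsum_vec TYPE('a) n (\<lambda>k. (verschiebung ^^ k) a) {0..n - 1} = prefix_sums a"
proof (rule eq_vecI)
  have dim: "dim_vec a = n"
    using assms by simp
  have closed: "(\<lambda>k. (verschiebung ^^ k) a) \<in> {0..n - 1} \<rightarrow> carrier_vec n"
    by (auto intro: carrier_vecI simp: dim)
  show "dim_vec (finsum_vec TYPE('a) n (\<lambda>k. (verschiebung ^^ k) a) {0..n - 1})
      = dim_vec (prefix_sums a)"
    using finsum_vec_closed[OF closed] by (simp add: dim)
  fix i
  assume "i < dim_vec (prefix_sums a)"
  then have i: "i < n"
    by (simp add: dim)
  have "finsum_vec TYPE('a) n (\<lambda>k. (verschiebung ^^ k) a) {0..n - 1} $ i
      = (\<Sum>k = 0..n - 1. (verschiebung ^^ k) a $ i)"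
    using i closed by (simp add: index_finsum_vec)
  also have "\<dots> = (\<Sum>k\<le>i. a $ (i - k))"
    using i by (intro sum.mono_neutral_cong_right) (auto simp: index_verschiebung_funpow dim)
  also have "\<dots> = (\<Sum>j\<le>i. a $ j)"
    by (rule sum.reindex_bij_witness[where i = "\<lambda>j. i - j" and j = "\<lambda>j. i - j"]) auto
  finally show "finsum_vec TYPE('a) n (\<lambda>k. (verschiebung ^^ k) a) {0..n - 1} $ i
      = prefix_sums a $ i"
    using i by (simp add: prefix_sums_def dim)
qed

section \<open>Semantics of the machine\<close>

text \<open>
  Writing outside a register leaves it unchanged, and reading there yields an unspecified value;
  this is why all statements on cells are confined to indices below the length.
\<close>

lemma get_put:
  "snd c < dim_vec (s (fst c)) \<Longrightarrow> get (put c x s) d = (if d = c then x else get s d)"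
  by (cases c; cases d) (auto simp: get_def put_def)

lemma dim_exec:
  assumes "\<And>r. dim_vec (s r) = n"
  shows "dim_vec (exec I s r) = n"
  using assms by (cases I) (auto simp: put_def)

lemma dim_fold_exec:
  assumes "\<And>r. dim_vec (s r) = n"
  shows "dim_vec (fold exec P s r) = n"
  using assms by (induction P arbitrary: s) (simp_all add: dim_exec)

text \<open>
  After the step \<open>m\<close> the coordinates up to \<open>m\<close> are final and the others are still those of the
  input. Register 1 is overwritten by every shift before it is read, and so its content does not
  enter the invariant.
\<close>

lemma neumann_steps:
  assumes "s 0 = a" and "m < dim_vec a"
  shows "fold exec (concat (map (\<lambda>k. [Shift 1 0, Arith Add (0, k) (0, k) (1, k)]) [1..<Suc m])) s 0
    = vec (dim_vec a) (\<lambda>i. if i \<le> m then \<Sum>j\<le>i. a $ j else a $ i)"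
  using assms(2)
proof (induction m)
  case 0
  show ?case
    by (rule eq_vecI) (auto simp: assms(1))
next
  case (Suc m)
  define t where
    "t = fold exec (concat (map (\<lambda>k. [Shift 1 0, Arith Add (0, k) (0, k) (1, k)]) [1..<Suc m])) s"
  have t: "t 0 = vec (dim_vec a) (\<lambda>i. if i \<le> m then \<Sum>j\<le>i. a $ j else a $ i)"
    using Suc by (simp add: t_def)
  have "fold exec (concat (map (\<lambda>k. [Shift 1 0, Arith Add (0, k) (0, k) (1, k)]) [1..<Suc (Suc m)])) s
      = exec (Arith Add (0, Suc m) (0, Suc m) (1, Suc m)) (exec (Shift 1 0) t)"
    by (simp add: t_def)
  moreover have "exec (Arith Add (0, Suc m) (0, Suc m) (1, Suc m)) (exec (Shift 1 0) t) 0
      = vec (dim_vec a) (\<lambda>i. if i \<le> Suc m then \<Sum>j\<le>i. a $ j else a $ i)"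
    using Suc.prems
    by (intro eq_vecI) (auto simp: put_def get_def update_vec_def t le_Suc_eq add.commute)
  ultimately show ?case
    by simp
qed

lemma run_neumann_prog:
  assumes "n \<ge> 1" and "a \<in> carrier_vec n"
  shows "run (neumann_prog n) a = prefix_sums a"
proof -
  have "run (neumann_prog n) a = vec (dim_vec a) (\<lambda>i. if i \<le> n - 1 then \<Sum>j\<le>i. a $ j else a $ i)"
    using neumann_steps[where m = "n - 1" and a = a] assms
    by (simp add: run_def neumann_prog_def)
  also have "\<dots> = prefix_sums a"
    using assms by (intro eq_vecI) (auto simp: prefix_sums_def)
  finally show ?thesis .
qed

section \<open>The ghost system\<close>

lemma witt_poly_cong:
  "(\<And>i. i \<le> k \<Longrightarrow> X $ i = Y $ i) \<Longrightarrow> witt_poly p k X = witt_poly p k Y"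
  by (simp add: witt_poly_def)

lemma witt_poly_split_last:
  "witt_poly p k X = (\<Sum>i<k. of_nat p ^ i * (X $ i) ^ (p ^ (k - i))) + of_nat p ^ k * X $ k"
  by (simp add: witt_poly_def flip: lessThan_Suc_atMost)

text \<open>
  Where \<open>p\<close> is invertible, the ghost map is injective, because its last coordinate is linear in the
  last unknown with the leading coefficient \<open>p\<^sup>k\<close>. In characteristic \<open>p\<close> only \<open>X\<^sub>0\<close> would remain
  in the system.
\<close>

lemma witt_poly_inject:
  fixes X Y :: "'a::field vec"
  assumes p: "of_nat p \<noteq> (0 :: 'a)"
    and dim: "dim_vec X = n" "dim_vec Y = n"
    and eq: "\<And>k. k < n \<Longrightarrow> witt_poly p k X = witt_poly p k Y"
  shows "X = Y"
proof (rule eq_vecI)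
  fix k
  assume "k < dim_vec Y"
  then show "X $ k = Y $ k"
  proof (induction k rule: less_induct)
    case (less k)
    then have "(\<Sum>i<k. of_nat p ^ i * (X $ i) ^ (p ^ (k - i)))
        = (\<Sum>i<k. of_nat p ^ i * (Y $ i) ^ (p ^ (k - i)))"
      by (intro sum.cong) auto
    with eq[of k] less.prems dim p show ?case
      by (simp add: witt_poly_split_last)
  qed
qed (simp add: dim)

section \<open>Correctness of forward substitution\<close>

lemma get_replicate_mult:
  assumes "\<And>r. dim_vec (s r) = n" and "snd c < n" and "d \<noteq> c"
  shows "get (fold exec (replicate q (Arith Mul c c d)) s) e
    = (if e = c then get s c * get s d ^ q else get s e)"
  using assms(1)
proof (induction q arbitrary: s)
  case (Suc q)
  from Suc.prems have "\<And>r. dim_vec (exec (Arith Mul c c d) s r) = n"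
    by (rule dim_exec)
  from Suc.IH[OF this] show ?case
    using assms(2,3) by (simp add: get_put Suc.prems ac_simps)
qed simp

text \<open>
  The scratch cell \<open>(4, 0)\<close> is left out of the description: the program for a term overwrites it
  before reading it.
\<close>

lemma get_ghost_term_prog:
  assumes dim: "\<And>r. dim_vec (s r) = n" and "p > 0" "i < n" "k < n" and c: "c \<noteq> (4, 0)"
  shows "get (fold exec (ghost_term_prog p k i) s) c
    = (if c = (1, i) then get s (1, i) ^ p
       else if c = (0, k) then get s (0, k) - get s (2, i) * get s (1, i) ^ p
       else get s c)"
proof -
  define t where "t = fold exec (frobenius_prog p i) s"
  have dim_t: "\<And>r. dim_vec (t r) = n"
    unfolding t_def by (rule dim_fold_exec) (rule dim)
  have dim_move: "\<And>r. dim_vec (exec (Move (4, 0) (1, i)) s r) = n"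
    by (rule dim_exec) (rule dim)
  have t: "get t e = (if e = (1, i) then get s (1, i) ^ p else get s e)" if "e \<noteq> (4, 0)" for e
    using that get_replicate_mult[OF dim_move,
        where c = "(1, i)" and d = "(4, 0)" and q = "p - 1" and e = e] assms
    by (simp add: t_def frobenius_prog_def get_put flip: power_Suc)
  have "fold exec (ghost_term_prog p k i) s
      = exec (Arith Sub (0, k) (0, k) (4, 0)) (exec (Arith Mul (4, 0) (2, i) (1, i)) t)"
    by (simp add: ghost_term_prog_def t_def)
  moreover have "\<And>r. dim_vec (exec (Arith Mul (4, 0) (2, i) (1, i)) t r) = n"
    by (rule dim_exec) (rule dim_t)
  ultimately show ?thesis
    using assms by (simp add: get_put dim_t t)
qed

lemma get_ghost_terms:
  assumes dim: "\<And>r. dim_vec (s r) = n" and "p > 0" "k < n" "m \<le> k" and c: "c \<noteq> (4, 0)"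
  shows "get (fold exec (concat (map (ghost_term_prog p k) [0..<m])) s) c
    = (if fst c = 1 \<and> snd c < m then get s c ^ p
       else if c = (0, k) then get s (0, k) - (\<Sum>i<m. get s (2, i) * get s (1, i) ^ p)
       else get s c)"
  using \<open>m \<le> k\<close> c
proof (induction m arbitrary: c)
  case (Suc m)
  define t where "t = fold exec (concat (map (ghost_term_prog p k) [0..<m])) s"
  have dim_t: "\<And>r. dim_vec (t r) = n"
    unfolding t_def by (rule dim_fold_exec) (rule dim)
  have t: "get t c = (if fst c = 1 \<and> snd c < m then get s c ^ p
       else if c = (0, k) then get s (0, k) - (\<Sum>i<m. get s (2, i) * get s (1, i) ^ p)
       else get s c)" if "c \<noteq> (4, 0)" for c
    unfolding t_def using Suc.prems that by (intro Suc.IH) auto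
  have "fold exec (concat (map (ghost_term_prog p k) [0..<Suc m])) s
      = fold exec (ghost_term_prog p k m) t"
    by (simp add: t_def)
  moreover have "get (fold exec (ghost_term_prog p k m) t) c
    = (if c = (1, m) then get t (1, m) ^ p
       else if c = (0, k) then get t (0, k) - get t (2, m) * get t (1, m) ^ p
       else get t c)"
    using Suc.prems assms by (intro get_ghost_term_prog[OF dim_t]) auto
  ultimately show ?case
    using Suc.prems by (cases c) (auto simp: t less_Suc_eq)
qed auto

text \<open>
  The invariant at the start of the stage \<open>k\<close>. The exponent \<open>k - 1 - i\<close> is the one that the
  equation \<open>k - 1\<close> needed; the stage \<open>k\<close> raises it by one before it uses the power. Since an
  equation \<open>j < k\<close> involves no coordinate beyond \<open>j\<close>, it stays solved while the later coordinates
  of register 0 still hold those of \<open>W\<close>.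
\<close>

definition ghost_inv :: "nat \<Rightarrow> nat \<Rightarrow> 'a::field vec \<Rightarrow> nat \<Rightarrow> (nat \<Rightarrow> 'a vec) \<Rightarrow> bool" where
  "ghost_inv p n W k s \<longleftrightarrow>
     (\<forall>r. dim_vec (s r) = n) \<and>
     get s (3, 0) = of_nat p \<and>
     (\<forall>i<k. get s (2, i) = of_nat p ^ i) \<and>
     (\<forall>i<k. get s (1, i) = get s (0, i) ^ (p ^ (k - 1 - i))) \<and>
     (\<forall>j<k. witt_poly p j (s 0) = W $ j) \<and>
     (\<forall>j. k \<le> j \<and> j < n \<longrightarrow> get s (0, j) = W $ j)"

lemma ghost_inv_stage:
  fixes W :: "'a::field vec"
  assumes inv: "ghost_inv p n W k s" and p: "of_nat p \<noteq> (0 :: 'a)" and k: "k < n"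
  shows "ghost_inv p n W (Suc k) (fold exec (ghost_stage_prog p k) s)"
proof -
  have p_pos: "p > 0"
    using p by (cases p) auto
  have dim: "\<And>r. dim_vec (s r) = n" and s3: "get s (3, 0) = of_nat p"
    and s2: "\<And>i. i < k \<Longrightarrow> get s (2, i) = of_nat p ^ i"
    and s1: "\<And>i. i < k \<Longrightarrow> get s (1, i) = get s (0, i) ^ (p ^ (k - 1 - i))"
    and solved: "\<And>j. j < k \<Longrightarrow> witt_poly p j (s 0) = W $ j"
    and rest: "\<And>j. k \<le> j \<Longrightarrow> j < n \<Longrightarrow> get s (0, j) = W $ j"
    using inv by (auto simp: ghost_inv_def)
  have frob: "get s (1, i) ^ p = get s (0, i) ^ (p ^ (k - i))" if "i < k" for i
  proof -
    have "k - i = Suc (k - 1 - i)"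
      using that by simp
    then show ?thesis
      by (simp only: s1[OF that] power_Suc2 power_mult)
  qed
  define t where "t = fold exec (concat (map (ghost_term_prog p k) [0..<k])) s"
  have dim_t: "\<And>r. dim_vec (t r) = n"
    unfolding t_def by (rule dim_fold_exec) (rule dim)
  have t: "get t c = (if fst c = 1 \<and> snd c < k then get s c ^ p
       else if c = (0, k) then get s (0, k) - (\<Sum>i<k. get s (2, i) * get s (1, i) ^ p)
       else get s c)" if "c \<noteq> (4, 0)" for c
    unfolding t_def using that k p_pos by (intro get_ghost_terms[OF dim]) auto
  define I :: "'a instr"
    where "I = (if k = 0 then Load (2, 0) 1 else Arith Mul (2, k) (2, k - 1) (3, 0))"
  define u where "u = exec I t"
  have dim_u: "\<And>r. dim_vec (u r) = n"
    unfolding u_def by (rule dim_exec) (rule dim_t)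
  have "of_nat p ^ (k - 1) * of_nat p = (of_nat p ^ k :: 'a)" if "k > 0"
    using that by (simp flip: power_Suc2)
  then have u: "get u c = (if c = (2, k) then of_nat p ^ k else get t c)" for c
    using k by (cases "k = 0") (auto simp: u_def I_def get_put dim_t t s2 s3)
  define v where "v = exec (Arith Div (0, k) (0, k) (2, k)) u"
  have dim_v: "\<And>r. dim_vec (v r) = n"
    unfolding v_def by (rule dim_exec) (rule dim_u)
  define w where "w = exec (Move (1, k) (0, k)) v"
  have dim_w: "\<And>r. dim_vec (w r) = n"
    unfolding w_def by (rule dim_exec) (rule dim_v)
  have w_eq: "fold exec (ghost_stage_prog p k) s = w"
    by (simp add: ghost_stage_prog_def t_def u_def v_def w_def I_def)
  define x where
    "x = (W $ k - (\<Sum>i<k. of_nat p ^ i * get s (0, i) ^ (p ^ (k - i)))) / of_nat p ^ k"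
  have "(\<Sum>i<k. get s (2, i) * get s (1, i) ^ p)
      = (\<Sum>i<k. of_nat p ^ i * get s (0, i) ^ (p ^ (k - i)))"
    by (intro sum.cong refl) (simp add: s2 frob del: One_nat_def)
  then have "get u (0, k) / get u (2, k) = x"
    using k by (simp add: u t rest x_def del: One_nat_def)
  then have v: "get v c = (if c = (0, k) then x else get u c)" for c
    using k by (simp add: v_def get_put dim_u)
  have w: "get w c = (if c = (0, k) \<or> c = (1, k) then x else if c = (2, k) then of_nat p ^ k
       else if fst c = 1 \<and> snd c < k then get s c ^ p else get s c)" if "c \<noteq> (4, 0)" for c
    using that k by (auto simp: w_def get_put dim_v v u t)
  have w0: "w 0 $ i = (if i = k then x else s 0 $ i)" for i
    using w[of "(0, i)"] by (simp add: get_def)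
  \<comment> \<open>Dividing by \<open>p\<^sup>k\<close> solves the new equation; the old ones do not mention the cell \<open>k\<close>.\<close>
  have new: "witt_poly p k (w 0) = W $ k"
    using p by (simp add: witt_poly_split_last w0 x_def get_def)
  have old: "witt_poly p j (w 0) = W $ j" if "j < k" for j
  proof -
    have "witt_poly p j (w 0) = witt_poly p j (s 0)"
      using that by (intro witt_poly_cong) (simp add: w0)
    with solved[OF that] show ?thesis
      by simp
  qed
  show ?thesis
    unfolding w_eq ghost_inv_def
    using new old by (auto simp: less_Suc_eq dim_w w s3 s2 frob rest simp del: One_nat_def)
qed

lemma ghost_inv_stages:
  fixes W :: "'a::field vec"
  assumes "ghost_inv p n W 0 s" and "of_nat p \<noteq> (0 :: 'a)" and "k \<le> n"
  shows "ghost_inv p n W k (fold exec (concat (map (ghost_stage_prog p) [0..<k])) s)"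
  using \<open>k \<le> n\<close>
proof (induction k)
  case (Suc k)
  then have "ghost_inv p n W (Suc k) (fold exec (ghost_stage_prog p k)
      (fold exec (concat (map (ghost_stage_prog p) [0..<k])) s))"
    using assms by (intro ghost_inv_stage) auto
  then show ?case
    by simp
qed (use assms in simp)

lemma run_ghost_prog:
  fixes W :: "'a::field vec"
  assumes "n \<ge> 1" and W: "W \<in> carrier_vec n" and p: "of_nat p \<noteq> (0 :: 'a)"
  shows "run (ghost_prog p n) W \<in> carrier_vec n"
    and "\<And>k. k < n \<Longrightarrow> witt_poly p k (run (ghost_prog p n) W) = W $ k"
proof -
  define s :: "nat \<Rightarrow> 'a vec" where "s = (\<lambda>r. if r = 0 then W else 0\<^sub>v (dim_vec W))"
  define t where "t = exec (Load (3, 0) (of_nat p)) s"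
  have dim: "\<And>r. dim_vec (s r) = n"
    using W by (simp add: s_def)
  then have "\<And>r. dim_vec (t r) = n"
    unfolding t_def by (rule dim_exec)
  moreover have "get t (3, 0) = of_nat p" and "\<And>j. get t (0, j) = get s (0, j)"
    using \<open>n \<ge> 1\<close> by (simp_all add: t_def get_put dim)
  moreover have "\<And>j. get s (0, j) = W $ j"
    by (simp add: get_def s_def)
  ultimately have "ghost_inv p n W 0 t"
    by (simp add: ghost_inv_def)
  then have "ghost_inv p n W n (fold exec (concat (map (ghost_stage_prog p) [0..<n])) t)"
    using p by (rule ghost_inv_stages) simp
  moreover have "run (ghost_prog p n) W
      = fold exec (concat (map (ghost_stage_prog p) [0..<n])) t 0"
    by (simp add: run_def ghost_prog_def t_def s_def)
  ultimately show "run (ghost_prog p n) W \<in> carrier_vec n"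
    and "\<And>k. k < n \<Longrightarrow> witt_poly p k (run (ghost_prog p n) W) = W $ k"
    by (auto simp: ghost_inv_def intro: carrier_vecI)
qed

section \<open>Costs\<close>

lemma prog_cost_append: "prog_cost t (P @ Q) = prog_cost t P + prog_cost t Q"
  by (simp add: prog_cost_def)

lemma prog_cost_concat: "prog_cost t (concat Ps) = sum_list (map (prog_cost t) Ps)"
  by (induction Ps) (simp_all add: prog_cost_append, simp add: prog_cost_def)

lemma prog_cost_neumann_prog: "prog_cost t (neumann_prog n) = (n - 1) * (t + 1)"
  by (simp add: neumann_prog_def prog_cost_concat o_def)
    (simp add: prog_cost_def sum_list_triv)

lemma prog_cost_ghost_term_prog: "p > 0 \<Longrightarrow> prog_cost t (ghost_term_prog p k i) = p + 2"
  by (simp add: ghost_term_prog_def frobenius_prog_def prog_cost_def sum_list_replicate)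

lemma prog_cost_ghost_stage_prog:
  assumes "p > 0"
  shows "prog_cost t (ghost_stage_prog p k :: 'a::field instr list) = k * (p + 2) + 3"
proof -
  have "prog_cost t (concat (map (ghost_term_prog p k) [0..<k]) :: 'a instr list) = k * (p + 2)"
    using assms
    by (simp add: prog_cost_concat o_def prog_cost_ghost_term_prog sum_list_triv)
  then show ?thesis
    by (simp add: ghost_stage_prog_def prog_cost_append) (simp add: prog_cost_def)
qed

lemma prog_cost_ghost_prog:
  assumes "p > 0"
  shows "2 * real (prog_cost t (ghost_prog p n :: 'a::field instr list))
    = (real p + 2) * (real n * (real n - 1)) + 6 * real n + 2"
proof -
  have "prog_cost t (ghost_prog p n :: 'a instr list) = 1 + (\<Sum>k<n. k * (p + 2) + 3)"
  proof -
    have "prog_cost t (ghost_prog p n :: 'a instr list)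
        = 1 + prog_cost t (concat (map (ghost_stage_prog p) [0..<n]) :: 'a instr list)"
      by (simp add: ghost_prog_def prog_cost_def)
    also have "\<dots> = 1 + (\<Sum>k<n. k * (p + 2) + 3)"
      using assms
      by (simp add: prog_cost_concat o_def prog_cost_ghost_stage_prog
          interv_sum_list_conv_sum_set_nat atLeast0LessThan)
    finally show ?thesis .
  qed
  moreover have "2 * real (1 + (\<Sum>k<n. k * (p + 2) + 3))
      = (real p + 2) * (real n * (real n - 1)) + 6 * real n + 2"
    by (induction n) (simp_all add: algebra_simps)
  ultimately show ?thesis
    by simp
qed

lemma neumann_cost_linear:
  assumes "(\<lambda>n. real (\<tau> n)) \<in> O(\<lambda>_. 1)"
  shows "(\<lambda>n. real (prog_cost (\<tau> n) (neumann_prog n))) \<in> O(\<lambda>n. real n)"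
proof -
  have "(\<lambda>n. real (n - 1)) \<in> O(\<lambda>n. real n)"
    by (intro bigoI[where c = 1]) (simp add: eventually_at_top_linorder)
  moreover have "(\<lambda>n. real (\<tau> n) + 1) \<in> O(\<lambda>_. 1)"
    using assms by (intro sum_in_bigo) simp_all
  ultimately have "(\<lambda>n. real (n - 1) * (real (\<tau> n) + 1)) \<in> O(\<lambda>n. real n * 1)"
    by (rule landau_o.big.mult)
  then show ?thesis
    by (simp only: prog_cost_neumann_prog of_nat_mult of_nat_add of_nat_1 mult_1_right)
qed

lemma ghost_cost_quadratic:
  assumes "p > 0"
  shows "(\<lambda>n. real (prog_cost (\<tau> n) (ghost_prog p n :: 'a::field instr list)))
    \<in> \<Theta>(\<lambda>n. real n ^ 2)"
proof (rule bigthetaI)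
  let ?cost = "\<lambda>n. real (prog_cost (\<tau> n) (ghost_prog p n :: 'a instr list))"
  have bounds: "?cost n \<le> (real p + 6) * real n ^ 2 \<and> real n ^ 2 \<le> 2 * ?cost n" if "n \<ge> 1" for n
  proof -
    have le: "real n \<le> real n ^ 2" "1 \<le> real n ^ 2"
      using that by (simp_all add: self_le_power)
    define Q where "Q = (real p + 2) * (real n ^ 2 - real n)"
    have cost: "2 * ?cost n = Q + 6 * real n + 2"
      using prog_cost_ghost_prog[OF assms, where t = "\<tau> n" and n = n and ?'a = 'a]
      by (simp add: Q_def power2_eq_square algebra_simps)
    have "Q \<le> (real p + 2) * real n ^ 2"
      unfolding Q_def by (intro mult_left_mono) auto
    then have "2 * ?cost n \<le> (real p + 2) * real n ^ 2 + 8 * real n ^ 2"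
      using cost le by linarith
    also have "\<dots> \<le> 2 * ((real p + 6) * real n ^ 2)"
      by (simp add: algebra_simps)
    finally have "?cost n \<le> (real p + 6) * real n ^ 2"
      by simp
    moreover have "real n ^ 2 - real n \<le> Q"
      using mult_right_mono[of 1 "real p + 2" "real n ^ 2 - real n"] le by (simp add: Q_def)
    then have "real n ^ 2 \<le> 2 * ?cost n"
      using cost by linarith
    ultimately show ?thesis
      by simp
  qed
  show "?cost \<in> O(\<lambda>n. real n ^ 2)"
    using bounds by (intro bigoI[where c = "real p + 6"])
      (auto simp: eventually_at_top_linorder intro!: exI[of _ 1])
  show "?cost \<in> \<Omega>(\<lambda>n. real n ^ 2)"
    unfolding bigomega_iff_bigo
    using bounds by (intro bigoI[where c = 2])
      (auto simp: eventually_at_top_linorder intro!: exI[of _ 1])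
qed

section \<open>Comparison of the two methods\<close>

theorem corollary7:
  fixes p :: nat and \<tau> :: "nat \<Rightarrow> nat"
  assumes "p = CARD('p::prime_card)"
    and "(\<lambda>n. real (\<tau> n)) \<in> O(\<lambda>_. 1)"
  shows
    "(\<forall>n\<ge>1.
        (\<forall>a \<in> carrier_vec n. (verschiebung ^^ n) a = (0\<^sub>v n :: 'p mod_ring vec)) \<and>
        bij_betw (\<lambda>a. a - verschiebung a)
          (carrier_vec n :: 'p mod_ring vec set) (carrier_vec n) \<and>
        (\<forall>a \<in> carrier_vec n :: 'p mod_ring vec set.
           inv_into (carrier_vec n) (\<lambda>a. a - verschiebung a) a =
             finsum_vec TYPE('p mod_ring) n (\<lambda>k. (verschiebung ^^ k) a) {0..n - 1} \<and>
           run (neumann_prog n) a =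
             inv_into (carrier_vec n) (\<lambda>a. a - verschiebung a) a)) \<and>
     (\<lambda>n. real (prog_cost (\<tau> n) (neumann_prog n :: 'p mod_ring instr list)))
        \<in> O(\<lambda>n. real n) \<and>
     (\<forall>n\<ge>1. \<forall>W \<in> carrier_vec n. \<forall>X \<in> carrier_vec n :: rat vec set.
        X = run (ghost_prog p n) W \<longleftrightarrow> (\<forall>k<n. W $ k = witt_poly p k X)) \<and>
     (\<lambda>n. real (prog_cost (\<tau> n) (ghost_prog p n :: rat instr list)))
        \<in> \<Theta>(\<lambda>n. real n ^ 2)"
proof (intro conjI allI ballI impI)
  fix n :: nat
  assume n: "n \<ge> 1"
  fix a :: "'p mod_ring vec"
  assume a: "a \<in> carrier_vec n"
  show "(verschiebung ^^ n) a = 0\<^sub>v n"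
    using verschiebung_nilpotent[of a] a by simp
  show "inv_into (carrier_vec n) (\<lambda>a. a - verschiebung a) a
      = finsum_vec TYPE('p mod_ring) n (\<lambda>k. (verschiebung ^^ k) a) {0..n - 1}"
    by (simp only: inv_into_difference[OF a] neumann_series_eq_prefix_sums[OF a])
  show "run (neumann_prog n) a = inv_into (carrier_vec n) (\<lambda>a. a - verschiebung a) a"
    by (simp only: inv_into_difference[OF a] run_neumann_prog[OF n a])
next
  show "bij_betw (\<lambda>a. a - verschiebung a)
      (carrier_vec n :: 'p mod_ring vec set) (carrier_vec n)" for n
    by (rule bij_betw_difference)
next
  show "(\<lambda>n. real (prog_cost (\<tau> n) (neumann_prog n :: 'p mod_ring instr list)))
      \<in> O(\<lambda>n. real n)"
    using assms(2) by (rule neumann_cost_linear)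
next
  have p_pos: "p > 0"
    using assms(1) prime_card[where ?'a = 'p] by (simp add: prime_gt_0_nat)
  then show "(\<lambda>n. real (prog_cost (\<tau> n) (ghost_prog p n :: rat instr list)))
      \<in> \<Theta>(\<lambda>n. real n ^ 2)"
    by (rule ghost_cost_quadratic)
  fix n :: nat and W X :: "rat vec"
  assume n: "n \<ge> 1" and W: "W \<in> carrier_vec n" and X: "X \<in> carrier_vec n"
  have p: "of_nat p \<noteq> (0 :: rat)"
    using p_pos by simp
  note ghost = run_ghost_prog[OF n W p]
  show "X = run (ghost_prog p n) W \<longleftrightarrow> (\<forall>k<n. W $ k = witt_poly p k X)"
  proof
    assume "X = run (ghost_prog p n) W"
    then show "\<forall>k<n. W $ k = witt_poly p k X"
      by (simp add: ghost(2))
  next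
    assume "\<forall>k<n. W $ k = witt_poly p k X"
    then show "X = run (ghost_prog p n) W"
      using X ghost by (intro witt_poly_inject[OF p, where n = n]) auto
  qed
qed

end
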